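(* For every number of agents $n\ge 2$, the strict competitive ratio of any deterministic online algorithm for the online max-min fair allocation problem is $0$ in the adversarial arrival model.
   Context: Setting (online max-min fair allocation, adversarial arrival). There are agents $N=\{1,\dots,n\}$; a finite sequence $\sigma$ of items arrives one by one. On arrival of an item $e$ its value vector $(v_1(e),\dots,v_n(e))\in[0,1]^n$ is revealed, and $e$ must be irrevocably given to one agent; the number of items is not known in advance. Valuations are additive: $v_i(X)=\sum_{e\in X}v_i(e)$. A deterministic online algorithm's decision for an item is a function of the value vectors revealed so far (including that of the current item). $\mathrm{ALG}(\sigma)$ is $\min_{i\in N}v_i(A_i)$ for the allocation produced by the algorithm on $\sigma$, and $\mathrm{OPT}(\sigma)$ is the maximum of $\min_{i\in N}v_i(A_i)$ over all allocations (partitions of the items into $n$ parts). The strict competitive ratio of $\mathrm{ALG}$ is $\inf_\sigma \mathrm{ALG}(\sigma)/\mathrm{OPT}(\sigma)$ (over $\sigma$ with $\mathrm{OPT}(\sigma)>0$). *)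

theory Defs
  imports Complex_Main "HOL-Library.FuncSet"
begin

definition agents :: "nat \<Rightarrow> nat set" where
  "agents n = {1..n}"

text \<open>
  An item is represented by its value vector. Functions are required to be undefined outside
  the set of agents, so that the vector reveals nothing but the values of the n agents.
\<close>

type_synonym item = "nat \<Rightarrow> real"

definition value_vectors :: "nat \<Rightarrow> item set" where
  "value_vectors n = agents n \<rightarrow>\<^sub>E {0..1}"

definition instances :: "nat \<Rightarrow> item list set" where
  "instances n = lists (value_vectors n)"

text \<open>
  The items of an arrival sequence are identified with their positions, so that items with equal
  value vectors stay distinct. An allocation maps each item to the agent receiving it; its fibres
  are the parts of the partition, and empty parts are allowed.
\<close>

definition valuation :: "item list \<Rightarrow> nat \<Rightarrow> nat set \<Rightarrow> real" where
  "valuation \<sigma> i X = (\<Sum>t\<in>X. (\<sigma> ! t) i)"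

definition allocations :: "nat \<Rightarrow> item list \<Rightarrow> (nat \<Rightarrow> nat) set" where
  "allocations n \<sigma> = {..<length \<sigma>} \<rightarrow>\<^sub>E agents n"

definition share :: "item list \<Rightarrow> (nat \<Rightarrow> nat) \<Rightarrow> nat \<Rightarrow> nat set" where
  "share \<sigma> a i = {t. t < length \<sigma> \<and> a t = i}"

definition min_value :: "nat \<Rightarrow> item list \<Rightarrow> (nat \<Rightarrow> nat) \<Rightarrow> real" where
  "min_value n \<sigma> a = Min ((\<lambda>i. valuation \<sigma> i (share \<sigma> a i)) ` agents n)"

definition OPT :: "nat \<Rightarrow> item list \<Rightarrow> real" where
  "OPT n \<sigma> = Max (min_value n \<sigma> ` allocations n \<sigma>)"

text \<open>
  A deterministic online algorithm maps the nonempty sequence of value vectors revealed so far,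
  the last of which belongs to the current item, to the agent that receives the current item.
  Past decisions need not be an argument, being determined by the same sequence.
\<close>

type_synonym algorithm = "item list \<Rightarrow> nat"

definition online_algorithm :: "nat \<Rightarrow> algorithm \<Rightarrow> bool" where
  "online_algorithm n alg \<longleftrightarrow> (\<forall>\<sigma>\<in>instances n. \<sigma> \<noteq> [] \<longrightarrow> alg \<sigma> \<in> agents n)"

definition alg_allocation :: "algorithm \<Rightarrow> item list \<Rightarrow> nat \<Rightarrow> nat" where
  "alg_allocation alg \<sigma> = (\<lambda>t\<in>{..<length \<sigma>}. alg (take (Suc t) \<sigma>))"

definition ALG :: "nat \<Rightarrow> algorithm \<Rightarrow> item list \<Rightarrow> real" where
  "ALG n alg \<sigma> = min_value n \<sigma> (alg_allocation alg \<sigma>)"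

definition strict_competitive_ratio :: "nat \<Rightarrow> algorithm \<Rightarrow> real" where
  "strict_competitive_ratio n alg =
     (INF \<sigma>\<in>{\<sigma> \<in> instances n. OPT n \<sigma> > 0}. ALG n alg \<sigma> / OPT n \<sigma>)"

end

theory Submission
  imports Defs "HOL-Combinatorics.Transposition"
begin

text \<open>
  The ratio 0 is attained. The adversary first presents an item of value 1 to everybody; if it goes
  to agent j, the next item is worth 1 to j and nothing to all others, and n - 2 further items
  of value 1 to everybody follow. Apart from the second item there are only n - 1 items, so some
  agent receives none of them; this agent is not j, and hence ends up with value 0. Offline, j takes
  the second item and everybody obtains value 1.
\<close>

definition common_item :: "nat \<Rightarrow> item" where
  "common_item n = (\<lambda>i\<in>agents n. 1)"

definition exclusive_item :: "nat \<Rightarrow> nat \<Rightarrow> item" where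
  "exclusive_item n j = (\<lambda>i\<in>agents n. of_bool (i = j))"

text \<open>Positions count from 0, so the second item to arrive is the one at
  \<open>t = 1\<close>.\<close>

definition adversarial_instance :: "nat \<Rightarrow> nat \<Rightarrow> item list" where
  "adversarial_instance n j =
     map (\<lambda>t. if t = 1 then exclusive_item n j else common_item n) [0..<n]"

lemma length_adversarial_instance [simp]: "length (adversarial_instance n j) = n"
  by (simp add: adversarial_instance_def)

lemma nth_adversarial_instance:
  "t < n \<Longrightarrow>
     adversarial_instance n j ! t = (if t = 1 then exclusive_item n j else common_item n)"
  by (simp add: adversarial_instance_def)

text \<open>The first prefix does not depend on \<open>j\<close>. This makes it legitimate to choose
  \<open>j\<close> as the reply of the algorithm to that prefix.\<close>

lemma take_1_adversarial_instance:
  "n > 0 \<Longrightarrow> take (Suc 0) (adversarial_instance n j) = [common_item n]"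
  by (simp add: adversarial_instance_def take_map upt_conv_Cons)

lemma common_item_in_value_vectors: "common_item n \<in> value_vectors n"
  by (auto simp: common_item_def value_vectors_def)

lemma adversarial_instance_in_instances: "adversarial_instance n j \<in> instances n"
  by (auto simp: adversarial_instance_def instances_def value_vectors_def common_item_def
      exclusive_item_def)

lemma finite_agents [simp]: "finite (agents n)"
  by (simp add: agents_def)

lemma finite_allocations: "finite (allocations n \<sigma>)"
  by (auto simp: allocations_def intro!: finite_PiE)

lemma finite_share [simp]: "finite (share \<sigma> a i)"
  by (simp add: share_def)

lemma item_value_nonneg:
  assumes "\<sigma> \<in> instances n" "i \<in> agents n" "t < length \<sigma>"
  shows "(\<sigma> ! t) i \<ge> 0"
proof -
  have "\<sigma> ! t \<in> value_vectors n"
    using assms by (auto simp: instances_def)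
  then show ?thesis
    using assms(2) by (auto simp: value_vectors_def PiE_iff)
qed

lemma valuation_share_nonneg:
  assumes "\<sigma> \<in> instances n" "i \<in> agents n"
  shows "valuation \<sigma> i (share \<sigma> a i) \<ge> 0"
  using assms by (auto simp: valuation_def share_def intro!: sum_nonneg item_value_nonneg)

lemma min_value_le:
  "i \<in> agents n \<Longrightarrow> min_value n \<sigma> a \<le> valuation \<sigma> i (share \<sigma> a i)"
  by (simp add: min_value_def)

lemma min_value_ge:
  assumes "n > 0" "\<And>i. i \<in> agents n \<Longrightarrow> c \<le> valuation \<sigma> i (share \<sigma> a i)"
  shows "c \<le> min_value n \<sigma> a"
proof -
  have "agents n \<noteq> {}"
    using assms(1) by (auto simp: agents_def)
  then show ?thesis
    using assms(2) by (simp add: min_value_def)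
qed

lemma min_value_le_OPT: "a \<in> allocations n \<sigma> \<Longrightarrow> min_value n \<sigma> a \<le> OPT n \<sigma>"
  by (simp add: OPT_def finite_allocations)

lemma ALG_nonneg: "n > 0 \<Longrightarrow> \<sigma> \<in> instances n \<Longrightarrow> ALG n alg \<sigma> \<ge> 0"
  by (auto simp: ALG_def intro!: min_value_ge valuation_share_nonneg)

lemma OPT_adversarial_instance_ge_1:
  assumes "n \<ge> 2" "j \<in> agents n"
  shows "OPT n (adversarial_instance n j) \<ge> 1"
proof -
  let ?\<sigma> = "adversarial_instance n j"
  \<comment> \<open>One item per agent: position \<open>t\<close> goes to agent
    \<open>Suc t\<close>, with agents 2 and \<open>j\<close> swapped so that the exclusive item at
    position 1 reaches \<open>j\<close>.\<close>
  define b where "b = (\<lambda>t\<in>{..<n}. transpose 2 j (Suc t))"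
  have perm: "transpose 2 j i \<in> {1..n}" if "i \<in> {1..n}" for i
    using that assms by (auto simp: transpose_def agents_def)
  have "b \<in> allocations n ?\<sigma>"
    using perm by (auto simp: allocations_def agents_def b_def)
  moreover have "1 \<le> min_value n ?\<sigma> b"
  proof (rule min_value_ge)
    fix i assume i: "i \<in> agents n"
    \<comment> \<open>A transposition is its own inverse, so this is the position that
      \<open>b\<close> gives to \<open>i\<close>; the subtraction is not truncated, as the swapped
      index is at least 1.\<close>
    define t where "t = transpose 2 j i - 1"
    have t: "t < n" "Suc t = transpose 2 j i"
      using perm[of i] i by (auto simp: agents_def t_def)
    have mem: "t \<in> share ?\<sigma> b i"
      using t by (simp add: share_def b_def)
    have "i = j" if "t = 1"
      using t that by (metis Suc_1 transpose_apply_first transpose_involutory)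
    then have "1 = (?\<sigma> ! t) i"
      using t(1) i by (auto simp: nth_adversarial_instance exclusive_item_def common_item_def)
    \<comment> \<open>Item \<open>t\<close> alone is worth 1 to \<open>i\<close>; nonnegativity of
      the values does the rest.\<close>
    also have "\<dots> \<le> (\<Sum>s\<in>share ?\<sigma> b i. (?\<sigma> ! s) i)"
      using mem i by (intro member_le_sum)
        (auto simp: share_def intro!: item_value_nonneg[OF adversarial_instance_in_instances])
    finally show "1 \<le> valuation ?\<sigma> i (share ?\<sigma> b i)"
      by (simp add: valuation_def)
  qed (use assms in simp)
  ultimately show ?thesis
    using min_value_le_OPT order_trans by blast
qed

text \<open>Pigeonhole: the \<open>n - 1\<close> common items cannot reach all \<open>n\<close>
  agents.\<close>

lemma ALG_adversarial_instance:
  assumes "n \<ge> 2"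
  shows "ALG n alg (adversarial_instance n (alg [common_item n])) = 0"
proof (rule antisym)
  define j where "j = alg [common_item n]"
  define \<sigma> where "\<sigma> = adversarial_instance n j"
  define a where "a = alg_allocation alg \<sigma>"
  have a0: "a 0 = j"
    using assms
    by (simp add: a_def alg_allocation_def \<sigma>_def take_1_adversarial_instance j_def)
  let ?T = "{..<n} - {1}"
  have "card (a ` ?T) \<le> card ?T"
    by (rule card_image_le) simp
  also have "\<dots> < card (agents n)"
    using assms by (simp add: agents_def)
  finally have "\<not> agents n \<subseteq> a ` ?T"
    by (meson card_mono finite_Diff finite_imageI finite_lessThan not_le)
  then obtain i where i: "i \<in> agents n" "i \<notin> a ` ?T"
    by blast
  \<comment> \<open>The common item at position 0 went to \<open>j\<close>, so the agent
    \<open>i\<close> without common items differs from \<open>j\<close> and values the exclusive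
    item at 0.\<close>
  have "0 \<in> ?T"
    using assms by simp
  with i(2) a0 have "i \<noteq> j"
    by blast
  have "(\<sigma> ! t) i = 0" if "t \<in> share \<sigma> a i" for t
  proof -
    have "t = 1"
      using that i(2) by (auto simp: share_def \<sigma>_def)
    then show ?thesis
      using assms i(1) \<open>i \<noteq> j\<close>
      by (simp add: \<sigma>_def nth_adversarial_instance exclusive_item_def)
  qed
  then have "valuation \<sigma> i (share \<sigma> a i) = 0"
    by (simp add: valuation_def)
  then show "ALG n alg (adversarial_instance n (alg [common_item n])) \<le> 0"
    using min_value_le[OF i(1), of \<sigma> a] by (simp add: ALG_def a_def \<sigma>_def j_def)
next
  show "0 \<le> ALG n alg (adversarial_instance n (alg [common_item n]))"
    using assms by (intro ALG_nonneg adversarial_instance_in_instances) simp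
qed

theorem theorem7:
  fixes n :: nat and alg :: algorithm
  assumes "n \<ge> 2"
    and "online_algorithm n alg"
  shows "strict_competitive_ratio n alg = 0"
proof -
  let ?S = "{\<sigma> \<in> instances n. OPT n \<sigma> > 0}"
  define j where "j = alg [common_item n]"
  define \<sigma> where "\<sigma> = adversarial_instance n j"
  \<comment> \<open>\<open>online_algorithm\<close> restricts replies only on valid instances, and
    the offline bound requires \<open>j\<close> to be an agent.\<close>
  have "[common_item n] \<in> instances n"
    by (simp add: instances_def common_item_in_value_vectors)
  then have "j \<in> agents n"
    using assms(2) by (auto simp: j_def online_algorithm_def)
  then have "OPT n \<sigma> \<ge> 1"
    using OPT_adversarial_instance_ge_1 assms(1) by (simp add: \<sigma>_def)
  then have mem: "\<sigma> \<in> ?S"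
    by (simp add: \<sigma>_def adversarial_instance_in_instances)
  \<comment> \<open>An infimum of reals is meaningful only for a nonempty set bounded below:
    \<open>mem\<close> gives the former, this fact the latter.\<close>
  have nonneg: "0 \<le> ALG n alg \<tau> / OPT n \<tau>" if "\<tau> \<in> ?S" for \<tau>
    using that assms(1) by (auto intro!: divide_nonneg_pos ALG_nonneg)
  have "strict_competitive_ratio n alg \<le> ALG n alg \<sigma> / OPT n \<sigma>"
    unfolding strict_competitive_ratio_def
    by (rule cINF_lower[OF bdd_belowI2[where m = 0] mem]) (rule nonneg)
  moreover have "ALG n alg \<sigma> = 0"
    using ALG_adversarial_instance[OF assms(1)] by (simp add: \<sigma>_def j_def)
  moreover have "0 \<le> strict_competitive_ratio n alg"
    unfolding strict_competitive_ratio_def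
    using mem by (intro cINF_greatest nonneg) auto
  ultimately show ?thesis
    by simp
qed

end
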